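(* Every finite simple graph $G$ admits a $3$-labelling $\ell$ such that, writing $S_x = \{v \in V(G) : \rho_\ell(v) = x\}$, the induced subgraph $G[S_1]$ has maximum degree at most $1$ (i.e., it consists of a possibly empty matching together with isolated vertices), and $S_x$ is an independent set of $G$ for every $x \geq 2$.
   Context: A $3$-labelling of a graph $G$ is a map $\ell: E(G) \to \{1,2,3\}$. For a vertex $v$, $\rho_\ell(v)$ denotes the product of the labels $\ell(uv)$ over all edges $uv$ incident to $v$ (the empty product being $1$). *)

theory Defs
  imports "HOL-Library.FuncSet"
begin

text \<open>
  A simple graph is given by a vertex set \<open>V\<close> and a set \<open>E\<close> of edges; the edge \<open>uv\<close> is the
  two-element set \<open>{u, v}\<close>. The null graph (\<open>V = {}\<close>) is allowed.
\<close>

definition finite_simple_graph :: "'a set \<Rightarrow> 'a set set \<Rightarrow> bool" where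
  "finite_simple_graph V E \<longleftrightarrow> finite V \<and> (\<forall>e\<in>E. e \<subseteq> V \<and> card e = 2)"

definition incident_edges :: "'a set set \<Rightarrow> 'a \<Rightarrow> 'a set set" where
  "incident_edges E v = {e \<in> E. v \<in> e}"

definition degree :: "'a set set \<Rightarrow> 'a \<Rightarrow> nat" where
  "degree E v = card (incident_edges E v)"

text \<open>The inserted \<open>0\<close> only matters for \<open>V = {}\<close>: the null graph has maximum degree \<open>0\<close>.\<close>

definition max_degree :: "'a set \<Rightarrow> 'a set set \<Rightarrow> nat" where
  "max_degree V E = Max (insert 0 (degree E ` V))"

text \<open>For \<open>S \<subseteq> V\<close>, the subgraph induced by \<open>S\<close> has vertex set \<open>S\<close> and the following edges.\<close>

definition induced_edges :: "'a set set \<Rightarrow> 'a set \<Rightarrow> 'a set set" where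
  "induced_edges E S = {e \<in> E. e \<subseteq> S}"

definition independent_set :: "'a set \<Rightarrow> 'a set set \<Rightarrow> 'a set \<Rightarrow> bool" where
  "independent_set V E S \<longleftrightarrow> S \<subseteq> V \<and> (\<forall>u\<in>S. \<forall>v\<in>S. {u, v} \<notin> E)"

text \<open>Values of a labelling outside \<open>E\<close> are unconstrained and never used.\<close>

definition three_labelling :: "'a set set \<Rightarrow> ('a set \<Rightarrow> nat) \<Rightarrow> bool" where
  "three_labelling E l \<longleftrightarrow> l \<in> E \<rightarrow> {1, 2, 3}"

definition label_product :: "'a set set \<Rightarrow> ('a set \<Rightarrow> nat) \<Rightarrow> 'a \<Rightarrow> nat" where
  "label_product E l v = (\<Prod>e\<in>incident_edges E v. l e)"

definition product_class :: "'a set \<Rightarrow> 'a set set \<Rightarrow> ('a set \<Rightarrow> nat) \<Rightarrow> nat \<Rightarrow> 'a set" where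
  "product_class V E l x = {v \<in> V. label_product E l v = x}"

end

theory Submission
  imports Defs
begin

text \<open>
  Take a proper colouring in which every vertex has a neighbour of every smaller colour. Starting
  from the constant labelling \<open>1\<close>, treat the colours from the largest down to \<open>3\<close>, relabelling edges
  to smaller colours only: label \<open>2\<close> towards odd colours and \<open>3\<close> towards even ones. A vertex of odd
  colour then receives no \<open>3\<close> from above, and one of even colour no \<open>2\<close>, so one of the two exponents
  of its product \<open>2\<^sup>a 3\<^sup>b\<close> can be prescribed exactly and the parity of the other one chosen. This makes
  all vertices of colour at least \<open>3\<close> bichromatic (\<open>a, b > 0\<close>) and distinguishes different colours,
  while avoiding the products \<open>2 3\<^sup>b\<close> with \<open>b \<ge> 2\<close>.

  Colour classes \<open>1\<close> and \<open>2\<close> now carry powers of \<open>2\<close> and of \<open>3\<close> respectively, and the edges between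
  them are still labelled \<open>1\<close>. A vertex of class \<open>1\<close> with product \<open>1\<close> is paired off by a label \<open>2\<close> with
  a neighbour of product \<open>3\<^sup>b\<close>, \<open>b \<ge> 2\<close>, if one is available; otherwise, if it has at least two
  neighbours of product \<open>1\<close> left in class \<open>2\<close>, the edges to all of them get label \<open>3\<close>. After this the
  vertices of product \<open>1\<close> induce stars centred in class \<open>2\<close>. The centre of a star with at least two
  leaves gets a positive even number of \<open>2\<close>s, some of them used to make its non-leaf neighbours odd
  and the rest placed on one or two leaves.
\<close>

section \<open>Edges between the first two colour classes\<close>

text \<open>The vertices of \<open>A\<close> are served one after another, each taking a neighbour
  in \<open>C\<close> that is still free, if there is one. As \<open>Range M\<close> only grows, a
  vertex once blocked stays blocked. Uniqueness is recorded for the \<open>A\<close>-end alone,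
  since a vertex of \<open>A\<close> just has to find at least one partner.\<close>

lemma greedy_matching:
  assumes "finite A"
  shows "\<exists>M \<subseteq> R \<inter> A \<times> C. (\<forall>x x' y. (x, y) \<in> M \<longrightarrow> (x', y) \<in> M \<longrightarrow> x = x')
    \<and> (\<forall>x\<in>A - Domain M. R `` {x} \<inter> C \<subseteq> Range M)"
  using assms
proof (induction A rule: finite_induct)
  case empty
  show ?case by (rule exI[of _ "{}"]) auto
next
  case (insert a A)
  then obtain M where M: "M \<subseteq> R \<inter> A \<times> C"
    "\<forall>x x' y. (x, y) \<in> M \<longrightarrow> (x', y) \<in> M \<longrightarrow> x = x'"
    "\<forall>x\<in>A - Domain M. R `` {x} \<inter> C \<subseteq> Range M"
    by meson
  show ?case
  proof (cases "R `` {a} \<inter> C \<subseteq> Range M")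
    case True
    with M show ?thesis by (intro exI[of _ M]) auto
  next
    case False
    then obtain y where y: "(a, y) \<in> R" "y \<in> C" "y \<notin> Range M" by auto
    have "\<forall>x x' z. (x, z) \<in> insert (a, y) M \<longrightarrow> (x', z) \<in> insert (a, y) M \<longrightarrow> x = x'"
      using M(2) y(3) by blast
    moreover have "insert (a, y) M \<subseteq> R \<inter> insert a A \<times> C" using M(1) y by blast
    moreover have "\<forall>x\<in>insert a A - Domain (insert (a, y) M). R `` {x} \<inter> C \<subseteq> Range (insert (a, y) M)"
      using M(3) by auto
    ultimately show ?thesis by (intro exI[of _ "insert (a, y) M"] conjI)
  qed
qed

text \<open>The vertices of \<open>A\<close> are processed in turn: one with at least two uncovered
  neighbours in \<open>B\<close> takes all of them, any other takes none. As \<open>Range T\<close>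
  only grows, the covering property of the centres and the bound for the remaining vertices survive
  all later steps.\<close>

lemma greedy_stars:
  assumes "finite A" and "finite B"
  shows "\<exists>T \<subseteq> R \<inter> A \<times> B. (\<forall>x x' y. (x, y) \<in> T \<longrightarrow> (x', y) \<in> T \<longrightarrow> x = x')
    \<and> (\<forall>x\<in>Domain T. R `` {x} \<inter> B \<subseteq> Range T \<and> card (T `` {x}) \<ge> 2)
    \<and> (\<forall>x\<in>A - Domain T. card (R `` {x} \<inter> B - Range T) \<le> 1)"
  using assms(1)
proof (induction A rule: finite_induct)
  case empty
  show ?case by (rule exI[of _ "{}"]) auto
next
  case (insert a A)
  then obtain T where T: "T \<subseteq> R \<inter> A \<times> B"
    "\<forall>x x' y. (x, y) \<in> T \<longrightarrow> (x', y) \<in> T \<longrightarrow> x = x'"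
    "\<forall>x\<in>Domain T. R `` {x} \<inter> B \<subseteq> Range T \<and> card (T `` {x}) \<ge> 2"
    "\<forall>x\<in>A - Domain T. card (R `` {x} \<inter> B - Range T) \<le> 1"
    by meson
  define S where "S = R `` {a} \<inter> B - Range T"
  show ?case
  proof (cases "card S \<le> 1")
    case True
    with T show ?thesis by (intro exI[of _ T]) (auto simp: S_def)
  next
    case False
    define T' where "T' = T \<union> {a} \<times> S"
    have a: "a \<notin> Domain T" using T(1) insert.hyps by auto
    have "S \<noteq> {}" using False by auto
    then have dom: "Domain T' = insert a (Domain T)" and ran: "Range T' = Range T \<union> S"
      by (auto simp: T'_def)
    have img: "T' `` {x} = (if x = a then S else T `` {x})" for x
      using a by (auto simp: T'_def)
    have "T' \<subseteq> R \<inter> insert a A \<times> B" using T(1) by (auto simp: T'_def S_def)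
    moreover have "\<forall>x x' y. (x, y) \<in> T' \<longrightarrow> (x', y) \<in> T' \<longrightarrow> x = x'"
      using T(2) by (auto simp: T'_def S_def)
    moreover have "R `` {x} \<inter> B \<subseteq> Range T' \<and> card (T' `` {x}) \<ge> 2" if "x \<in> Domain T'" for x
    proof (cases "x = a")
      case True
      then show ?thesis using False unfolding ran img by (auto simp: S_def)
    next
      case False
      then have "x \<in> Domain T" using that dom by auto
      then show ?thesis using T(3) False unfolding ran img by auto
    qed
    moreover have "card (R `` {x} \<inter> B - Range T') \<le> 1" if "x \<in> insert a A - Domain T'" for x
    proof -
      have "card (R `` {x} \<inter> B - Range T') \<le> card (R `` {x} \<inter> B - Range T)"
        using assms(2) unfolding ran by (intro card_mono) auto
      also have "\<dots> \<le> 1" using T(4) that unfolding dom by auto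
      finally show ?thesis .
    qed
    ultimately show ?thesis by (intro exI[of _ T']) blast
  qed
qed

lemma card_le_one_iff_unique:
  assumes "finite A"
  shows "card A \<le> 1 \<longleftrightarrow> (\<forall>x\<in>A. \<forall>y\<in>A. x = y)"
  using assms card_le_Suc0_iff_eq[of A] by simp

text \<open>
  \<open>F\<close> and \<open>G\<close> are the edges that get label \<open>2\<close> and \<open>3\<close>; \<open>p\<close> and \<open>q\<close> are the exponents contributed by
  the larger colours. \<open>(a, b)\<close> and \<open>(c, d)\<close> are the resulting exponents of \<open>2\<close> and \<open>3\<close> on the two sides.
\<close>

lemma bipartite_relabelling:
  fixes p :: "'a \<Rightarrow> nat" and q :: "'b \<Rightarrow> nat"
  assumes fin: "finite X" "finite Y" and R: "R \<subseteq> X \<times> Y"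
  obtains F G a b c d where "F \<subseteq> R" "G \<subseteq> R" "F \<inter> G = {}"
    "\<And>x. a x = p x + card (F `` {x})" "\<And>x. b x = card (G `` {x})"
    "\<And>y. c y = card (F\<inverse> `` {y})" "\<And>y. d y = q y + card (G\<inverse> `` {y})"
    "\<And>x. x \<in> X \<Longrightarrow> a x = 0 \<or> b x = 0"
    "\<And>y. y \<in> Y \<Longrightarrow> c y = 0 \<or> d y = 0 \<or> c y = 1 \<and> d y \<ge> 2"
    "\<And>x y. (x, y) \<in> R \<Longrightarrow> a x = c y \<Longrightarrow> b x = d y \<Longrightarrow> a x = 0 \<and> b x = 0"
    "\<And>x y y'. (x, y) \<in> R \<Longrightarrow> (x, y') \<in> R \<Longrightarrow> a x = 0 \<Longrightarrow> b x = 0 \<Longrightarrow>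
       c y = 0 \<Longrightarrow> d y = 0 \<Longrightarrow> c y' = 0 \<Longrightarrow> d y' = 0 \<Longrightarrow> y = y'"
    "\<And>x x' y. (x, y) \<in> R \<Longrightarrow> (x', y) \<in> R \<Longrightarrow> c y = 0 \<Longrightarrow> d y = 0 \<Longrightarrow>
       a x = 0 \<Longrightarrow> b x = 0 \<Longrightarrow> a x' = 0 \<Longrightarrow> b x' = 0 \<Longrightarrow> x = x'"
proof -
  \<comment> \<open>\<open>X0\<close> and \<open>Y0\<close> are the vertices of product 1 before any
    edge of \<open>R\<close> is relabelled. Below, \<open>M\<close> will get label 2 and
    \<open>T\<close> label 3.\<close>
  define X0 where "X0 = {x\<in>X. p x = 0}"
  define Y0 where "Y0 = {y\<in>Y. q y = 0}"
  have "finite X0" using fin by (simp add: X0_def)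
  from greedy_matching[OF this, of R "{y\<in>Y. q y \<ge> 2}"] obtain M
    where M: "M \<subseteq> R \<inter> X0 \<times> {y\<in>Y. q y \<ge> 2}"
      and "\<forall>x x' y. (x, y) \<in> M \<longrightarrow> (x', y) \<in> M \<longrightarrow> x = x'"
      and M_max: "\<forall>x\<in>X0 - Domain M. R `` {x} \<inter> {y\<in>Y. q y \<ge> 2} \<subseteq> Range M"
    by (elim exE conjE)
  then have M_inj: "x = x'" if "(x, y) \<in> M" "(x', y) \<in> M" for x x' y
    using that by blast
  define X1 where "X1 = X0 - Domain M"
  have "finite X1" "finite Y0" using fin by (simp_all add: X1_def X0_def Y0_def)
  from greedy_stars[OF this, of R] obtain T where T: "T \<subseteq> R \<inter> X1 \<times> Y0"
      and "\<forall>x x' y. (x, y) \<in> T \<longrightarrow> (x', y) \<in> T \<longrightarrow> x = x'"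
      and T_dom: "\<forall>x\<in>Domain T. R `` {x} \<inter> Y0 \<subseteq> Range T \<and> card (T `` {x}) \<ge> 2"
      and T_max: "\<forall>x\<in>X1 - Domain T. card (R `` {x} \<inter> Y0 - Range T) \<le> 1"
    by (elim exE conjE)
  then have T_inj: "x = x'" if "(x, y) \<in> T" "(x', y) \<in> T" for x x' y
    using that by blast
  \<comment> \<open>Once \<open>M\<close> and \<open>T\<close> are labelled, \<open>X2\<close> and
    \<open>Y1\<close> are the vertices still of product 1. \<open>Z\<close> collects the centres
    whose stars have too many leaves to be left alone.\<close>
  define X2 where "X2 = X1 - Domain T"
  define Y1 where "Y1 = Y0 - Range T"
  define leaves where "leaves y = {x\<in>X2. (x, y) \<in> R}" for y
  define Z where "Z = {y\<in>Y1. card (leaves y) \<ge> 2}"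
  \<comment> \<open>\<open>p'\<close> is the exponent of 2 once \<open>M\<close> is labelled. One
    more edge labelled 2, towards the chosen centre \<open>g x\<close>, turns it odd for
    \<open>x\<close> in \<open>W\<close>; the centres themselves will be even.\<close>
  define p' where "p' x = p x + card (M `` {x})" for x
  define W where "W = {x\<in>X - X1. even (p' x) \<and> (\<exists>y\<in>Z. (x, y) \<in> R)}"
  define g where "g x = (SOME y. y \<in> Z \<and> (x, y) \<in> R)" for x
  have g: "g x \<in> Z" "(x, g x) \<in> R" if "x \<in> W" for x
    using someI_ex[of "\<lambda>y. y \<in> Z \<and> (x, y) \<in> R"] that by (auto simp: W_def g_def)
  define Q where "Q y = {x\<in>W. g x = y}" for y
  have "\<exists>K. K \<subseteq> leaves y \<and> even (card (Q y) + card K) \<and> card (Q y) + card K \<ge> 2"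
    if "y \<in> Z" for y
  proof -
    \<comment> \<open>An odd \<open>card (Q y)\<close> is at least 1, so a single leaf yields an
      even total of at least 2; an even one calls for two leaves. A centre in \<open>Z\<close> has
      that many.\<close>
    define k :: nat where "k = (if even (card (Q y)) then 2 else 1)"
    have "k \<le> card (leaves y)" using that by (auto simp: k_def Z_def)
    then obtain K where "K \<subseteq> leaves y" "card K = k" by (meson obtain_subset_with_card_n)
    moreover have "even (card (Q y) + k)" "card (Q y) + k \<ge> 2"
      by (auto simp: k_def elim: oddE)
    ultimately show ?thesis by auto
  qed
  then obtain K where K: "\<And>y. y \<in> Z \<Longrightarrow> K y \<subseteq> leaves y"
    "\<And>y. y \<in> Z \<Longrightarrow> even (card (Q y) + card (K y)) \<and> card (Q y) + card (K y) \<ge> 2"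
    by metis
  define F where "F = M \<union> {(x, g x) | x. x \<in> W} \<union> {(x, y). y \<in> Z \<and> x \<in> K y}"
  define a where "a x = p x + card (F `` {x})" for x
  define b where "b x = card (T `` {x})" for x
  define c where "c y = card (F\<inverse> `` {y})" for y
  define d where "d y = q y + card (T\<inverse> `` {y})" for y
  have finR: "finite R" using fin R finite_subset by blast
  have sub: "X1 \<subseteq> X0" "X0 \<subseteq> X" "X2 \<subseteq> X1" "Y1 \<subseteq> Y0" "Y0 \<subseteq> Y" "Z \<subseteq> Y1"
    by (auto simp: X1_def X0_def X2_def Y1_def Y0_def Z_def)
  have K_X2: "x \<in> X2" "(x, y) \<in> R" if "y \<in> Z" "x \<in> K y" for x y
    using K(1)[OF that(1)] that(2) by (auto simp: leaves_def)
  have finZ: "finite Z" and finX2: "finite X2" and finW: "finite W"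
  proof -
    show "finite Z" using finite_subset[OF _ fin(2)] sub by blast
    show "finite X2" using finite_subset[OF _ fin(1)] sub by blast
    show "finite W" using fin(1) by (simp add: W_def)
  qed
  have K_X1: "x \<notin> K y" if "y \<in> Z" "x \<notin> X1" for x y
    using K_X2(1) that sub(3) by blast
  \<comment> \<open>The bound in \<open>T_max\<close> makes the leaf sets of distinct centres
    disjoint.\<close>
  have uniq: "y = y'" if "x \<in> X2" "(x, y) \<in> R" "(x, y') \<in> R" "y \<in> Y1" "y' \<in> Y1" for x y y'
  proof -
    have "finite (R `` {x} \<inter> Y0 - Range T)" using fin by (auto simp: Y0_def)
    from card_le_one_iff_unique[OF this] T_max that show ?thesis
      by (auto simp: X2_def Y1_def)
  qed
  have FR: "F \<subseteq> R" using M g(2) K_X2(2) by (auto simp: F_def)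
  have TR: "T \<subseteq> R" using T by auto
  have img_out: "F `` {x} = M `` {x} \<union> (if x \<in> W then {g x} else {})" if "x \<in> X - X1" for x
    using that K_X1 by (auto simp: F_def)
  have img_in: "F `` {x} = {y\<in>Z. x \<in> K y}" if "x \<in> X1" for x
    using that M by (auto simp: F_def X1_def W_def)
  have T_out: "T `` {x} = {}" if "x \<notin> Domain T" for x using that by auto
  have b_out: "b x = 0" if "x \<notin> Domain T" for x using T_out[OF that] by (simp add: b_def)
  have a_out: "a x \<ge> 1 \<and> b x = 0 \<and> ((\<exists>y\<in>Z. (x, y) \<in> R) \<longrightarrow> odd (a x))" if "x \<in> X - X1" for x
  proof -
    have fM: "finite (M `` {x})" using finR M
      by (meson finite_Image finite_subset le_infE)
    have p1: "p' x \<ge> 1"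
    proof (cases "p x = 0")
      case True
      then have "x \<in> Domain M" using that by (auto simp: X1_def X0_def)
      then have "M `` {x} \<noteq> {}" by auto
      then have "card (M `` {x}) > 0" using fM by (simp add: card_gt_0_iff)
      then show ?thesis by (simp add: p'_def)
    qed (simp add: p'_def)
    \<comment> \<open>The edge to \<open>g x\<close> is a new one: partners in \<open>M\<close> have
      \<open>q\<close> at least 2, centres have \<open>q\<close> equal to 0.\<close>
    have "g x \<notin> M `` {x}" if "x \<in> W"
      using g[OF that] M sub by (fastforce simp: Y0_def)
    then have "a x = p' x + (if x \<in> W then 1 else 0)"
      using img_out[OF that] fM by (simp add: a_def p'_def)
    moreover have "b x = 0" using that T by (intro b_out) auto
    ultimately show ?thesis using p1 that by (auto simp: W_def)
  qed
  have F_T: "F `` {x} = {}" if "x \<in> Domain T" for x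
  proof -
    have "x \<in> X1" "x \<notin> X2" using that T by (auto simp: X2_def)
    then show ?thesis using img_in[of x] K_X2(1) by blast
  qed
  \<comment> \<open>At least two 3s here, against exactly one at each vertex of
    \<open>Range T\<close>, keep the two ends of an edge of \<open>T\<close> apart.\<close>
  have a_T: "a x = 0 \<and> b x \<ge> 2" if "x \<in> Domain T" for x
  proof -
    have "x \<in> X1" using that T by auto
    then show ?thesis using F_T[OF that] T_dom that sub by (auto simp: a_def b_def X0_def)
  qed
  have a_X2: "a x \<le> 1 \<and> b x = 0" if "x \<in> X2" for x
  proof -
    have "{y\<in>Z. x \<in> K y} \<subseteq> {y\<in>Z. (x, y) \<in> R}" using K_X2 by auto
    moreover have "finite {y\<in>Z. x \<in> K y}"
      using finZ by simp
    ultimately have "card {y\<in>Z. x \<in> K y} \<le> 1"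
      using uniq[OF that] sub(6) by (subst card_le_one_iff_unique) blast+
    moreover have "p x = 0" using that sub by (auto simp: X0_def)
    moreover have "b x = 0" using that by (intro b_out) (auto simp: X2_def)
    ultimately show ?thesis using img_in[of x] that sub by (auto simp: a_def)
  qed
  have a_X2_0: "a x = 0" if "x \<in> X2" "(x, y) \<in> R" "y \<in> Y1 - Z" for x y
  proof -
    have "x \<in> X1" using that(1) sub by blast
    moreover have "x \<notin> K z" if "z \<in> Z" for z
      using uniq[OF \<open>x \<in> X2\<close> \<open>(x, y) \<in> R\<close>, of z] K_X2(2)[of z x] \<open>y \<in> Y1 - Z\<close> that sub(6) by blast
    ultimately have "F `` {x} = {}" using img_in[of x] by blast
    then show ?thesis using \<open>x \<in> X1\<close> sub by (auto simp: a_def X0_def)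
  qed
  have T_inv: "T\<inverse> `` {y} = {}" if "y \<notin> Range T" for y using that by auto
  have c_Z: "even (c y) \<and> c y \<ge> 2 \<and> d y = 0" if "y \<in> Z" for y
  proof -
    have "F\<inverse> `` {y} = Q y \<union> K y"
      using that M sub by (fastforce simp: F_def Q_def Y0_def)
    moreover have "Q y \<inter> K y = {}"
      using K_X1[OF that] by (auto simp: Q_def W_def)
    moreover have "finite (Q y)" "finite (K y)"
      using finW finX2 K_X2(1)[OF that] by (auto simp: Q_def intro: finite_subset)
    ultimately have "c y = card (Q y) + card (K y)" by (simp add: c_def card_Un_disjoint)
    moreover have "d y = 0" using that T_inv[of y] sub by (auto simp: d_def Y1_def Y0_def Z_def)
    ultimately show ?thesis using K(2)[OF that] by simp
  qed
  have c_M: "c y = (if y \<in> Range M then 1 else 0)" if "y \<notin> Z" for y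
  proof -
    have *: "F\<inverse> `` {y} = M\<inverse> `` {y}" using that g by (auto simp: F_def)
    show ?thesis
    proof (cases "y \<in> Range M")
      case True
      then obtain x where "(x, y) \<in> M" by auto
      then have "M\<inverse> `` {y} = {x}" using M_inj by auto
      then show ?thesis using * True by (simp add: c_def)
    next
      case False
      then have "M\<inverse> `` {y} = {}" by auto
      then show ?thesis using * False by (simp add: c_def)
    qed
  qed
  have d_T: "d y = 1" if "y \<in> Range T" for y
  proof -
    from that obtain x where x: "(x, y) \<in> T" by auto
    then have "T\<inverse> `` {y} = {x}" using T_inj by auto
    then show ?thesis using x T by (auto simp: d_def Y0_def)
  qed
  have d_q: "d y = q y" if "y \<notin> Range T" for y
    using T_inv[OF that] by (simp add: d_def)
  have RM: "y \<notin> Z \<and> y \<notin> Range T \<and> q y \<ge> 2" if "y \<in> Range M" for y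
  proof -
    have "q y \<ge> 2" using that M by auto
    moreover from this have "y \<notin> Y0" by (simp add: Y0_def)
    ultimately show ?thesis using T sub by blast
  qed
  have cd_cases: "y \<in> Z \<or> (y \<in> Range M \<and> c y = 1 \<and> d y = q y \<and> q y \<ge> 2)
      \<or> (y \<in> Range T \<and> c y = 0 \<and> d y = 1)
      \<or> (y \<in> Y1 - Z \<and> c y = 0 \<and> d y = 0) \<or> (y \<notin> Range M \<and> c y = 0 \<and> d y = q y \<and> q y \<ge> 1)"
    if "y \<in> Y" for y
  proof (cases "y \<in> Z \<or> y \<in> Range M")
    case True
    then show ?thesis using c_M[of y] d_q[of y] RM[of y] by argo
  next
    case False
    then have c0: "c y = 0" using c_M[of y] by simp
    consider "y \<in> Range T" | "y \<notin> Range T" "q y = 0" | "y \<notin> Range T" "q y \<ge> 1" by linarith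
    then show ?thesis
    proof cases
      case 2
      then have "y \<in> Y1" using that by (simp add: Y1_def Y0_def)
      then show ?thesis using 2 False c0 d_q by simp
    qed (use False c0 d_T d_q in simp_all)
  qed
  have T_no: "y \<notin> Y1" if "x \<in> Domain T" "(x, y) \<in> R" for x y
    using T_dom that by (auto simp: Y1_def)
  have no_ge2: "y \<in> Range M" if "x \<in> X1" "(x, y) \<in> R" "q y \<ge> 2" for x y
    using M_max that R by (auto simp: X1_def)
  have x_cases: "x \<in> X - X1 \<or> x \<in> Domain T \<or> x \<in> X2" if "x \<in> X" for x
    using that by (auto simp: X2_def)
  \<comment> \<open>Equal exponents are excluded kind by kind. Outside \<open>X1\<close>, an odd
    number of 2s would meet the even number of a centre in \<open>Z\<close>. In
    \<open>Domain T\<close>, two or more 3s without a 2 would require an unmatched neighbour with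
    \<open>q y \<ge> 2\<close>, against \<open>no_ge2\<close>. In \<open>X2\<close>, at most one 2
    cannot equal the two or more at a centre in \<open>Z\<close>. Only stars with at most one leaf
    remain.\<close>
  have xy: "a x = 0 \<and> b x = 0 \<and> x \<in> X2 \<and> y \<in> Y1 - Z"
    if r: "(x, y) \<in> R" and e: "a x = c y" "b x = d y" for x y
  proof -
    have "x \<in> X" "y \<in> Y" using r R by auto
    from x_cases[OF this(1)] show ?thesis
    proof (elim disjE)
      assume "x \<in> X - X1"
      then show ?thesis using a_out[of x] cd_cases[OF \<open>y \<in> Y\<close>] c_Z[of y] r e by auto
    next
      assume x: "x \<in> Domain T"
      then have "x \<in> X1" using T by auto
      then show ?thesis
        using a_T[OF x] cd_cases[OF \<open>y \<in> Y\<close>] no_ge2[OF _ r] T_no[OF x r] sub(6) e by auto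
    next
      assume "x \<in> X2"
      then show ?thesis
        using a_X2[of x] a_X2_0[of x y] cd_cases[OF \<open>y \<in> Y\<close>] c_Z[of y] r e by auto
    qed
  qed
  show thesis
  proof (rule that[of F T a b c d])
    show "F \<subseteq> R" "T \<subseteq> R" by fact+
    show "F \<inter> T = {}" using F_T by auto
    show "a x = 0 \<or> b x = 0" if "x \<in> X" for x
      using x_cases[OF that] a_out[of x] a_T[of x] a_X2[of x] by auto
    show "c y = 0 \<or> d y = 0 \<or> c y = 1 \<and> d y \<ge> 2" if "y \<in> Y" for y
      using cd_cases[OF that] c_Z[of y] by auto
    show "a x = 0 \<and> b x = 0" if "(x, y) \<in> R" "a x = c y" "b x = d y" for x y
      using xy[OF that] by auto
    show "y = y'" if "(x, y) \<in> R" "(x, y') \<in> R" "a x = 0" "b x = 0"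
      "c y = 0" "d y = 0" "c y' = 0" "d y' = 0" for x y y'
      using xy[of x y] xy[of x y'] uniq[of x y y'] that by auto
    show "x = x'" if "(x, y) \<in> R" "(x', y) \<in> R" "c y = 0" "d y = 0"
      "a x = 0" "b x = 0" "a x' = 0" "b x' = 0" for x x' y
    proof -
      have *: "x \<in> leaves y" "x' \<in> leaves y" "y \<in> Y1 - Z"
        using xy[of x y] xy[of x' y] that by (auto simp: leaves_def)
      then have "card (leaves y) \<le> 1" by (auto simp: Z_def)
      moreover have "finite (leaves y)"
        using finX2 by (simp add: leaves_def)
      ultimately show ?thesis using * card_le_one_iff_unique by blast
    qed
  qed (simp_all add: a_def b_def c_def d_def)
qed

section \<open>Labellings and exponents\<close>

text \<open>For \<open>k = 2\<close> and \<open>k = 3\<close> this is the exponent of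
  \<open>k\<close> in the vertex product. Neighbours are counted instead of edges, so that images
  under relations enter directly.\<close>

definition label_degree :: "'a set set \<Rightarrow> ('a set \<Rightarrow> nat) \<Rightarrow> nat \<Rightarrow> 'a \<Rightarrow> nat" where
  "label_degree E l k v = card {u. {v, u} \<in> E \<and> l {v, u} = k}"

text \<open>This is applied to disjoint \<open>A\<close> and \<open>B\<close> consisting of edges
  labelled 1, so no earlier 2 or 3 is lost and the exponents can only grow.\<close>

definition relabel :: "('a set \<Rightarrow> nat) \<Rightarrow> 'a set set \<Rightarrow> 'a set set \<Rightarrow> 'a set \<Rightarrow> nat" where
  "relabel l A B e = (if e \<in> A then 2 else if e \<in> B then 3 else l e)"

lemma finite_neighbours:
  assumes "finite_simple_graph V E"
  shows "finite {u. {v, u} \<in> E}"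
proof (rule finite_subset)
  show "{u. {v, u} \<in> E} \<subseteq> V" "finite V" using assms by (auto simp: finite_simple_graph_def)
qed

lemma edge_endpoints:
  assumes "finite_simple_graph V E" and "{u, v} \<in> E"
  shows "u \<in> V" "v \<in> V" "u \<noteq> v"
  using assms by (auto simp: finite_simple_graph_def)

lemma label_degree_eq_0:
  assumes "\<And>u. {v, u} \<in> E \<Longrightarrow> l {v, u} \<noteq> k"
  shows "label_degree E l k v = 0"
proof -
  have "{u. {v, u} \<in> E \<and> l {v, u} = k} = {}" using assms by auto
  then show ?thesis unfolding label_degree_def by (simp only: card.empty)
qed

lemma label_degree_relabel:
  assumes G: "finite_simple_graph V E" and sub: "A \<subseteq> E" "B \<subseteq> E" and "A \<inter> B = {}"
    and one: "\<forall>e\<in>A \<union> B. l e = 1"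
  shows "label_degree E (relabel l A B) 2 v = label_degree E l 2 v + card {u. {v, u} \<in> A}"
    and "label_degree E (relabel l A B) 3 v = label_degree E l 3 v + card {u. {v, u} \<in> B}"
proof -
  have 2: "{u. {v, u} \<in> E \<and> relabel l A B {v, u} = 2}
      = {u. {v, u} \<in> E \<and> l {v, u} = 2} \<union> {u. {v, u} \<in> A}"
    using sub one by (auto simp: relabel_def)
  have 3: "{u. {v, u} \<in> E \<and> relabel l A B {v, u} = 3}
      = {u. {v, u} \<in> E \<and> l {v, u} = 3} \<union> {u. {v, u} \<in> B}"
    using sub one \<open>A \<inter> B = {}\<close> by (auto simp: relabel_def)
  have fin: "finite {u. {v, u} \<in> E \<and> l {v, u} = k}" "finite {u. {v, u} \<in> A}"
    "finite {u. {v, u} \<in> B}" for k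
    using sub by (auto intro: finite_subset[OF _ finite_neighbours[OF G, of v]])
  show "label_degree E (relabel l A B) 2 v = label_degree E l 2 v + card {u. {v, u} \<in> A}"
    unfolding label_degree_def 2 using one fin by (intro card_Un_disjoint) auto
  show "label_degree E (relabel l A B) 3 v = label_degree E l 3 v + card {u. {v, u} \<in> B}"
    unfolding label_degree_def 3 using one fin by (intro card_Un_disjoint) auto
qed

lemma three_labelling_relabel:
  assumes "three_labelling E l"
  shows "three_labelling E (relabel l A B)"
  using assms by (auto simp: three_labelling_def relabel_def Pi_iff)

text \<open>Edges at \<open>v\<close> correspond to neighbours of \<open>v\<close>, and each label
  is a factor 1 or 2 times a factor 1 or 3.\<close>

lemma label_product_eq:
  assumes G: "finite_simple_graph V E" and l: "three_labelling E l"
  shows "label_product E l v = 2 ^ label_degree E l 2 v * 3 ^ label_degree E l 3 v"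
proof -
  define N where "N = {u. {v, u} \<in> E}"
  have finN: "finite N" unfolding N_def by (rule finite_neighbours[OF G])
  have "incident_edges E v = (\<lambda>u. {v, u}) ` N"
  proof (intro equalityI subsetI)
    fix e assume "e \<in> incident_edges E v"
    then have e: "e \<in> E" "v \<in> e" by (auto simp: incident_edges_def)
    then obtain x y where "e = {x, y}" using G by (auto simp: finite_simple_graph_def card_2_iff)
    then show "e \<in> (\<lambda>u. {v, u}) ` N" using e by (auto simp: N_def insert_commute)
  qed (auto simp: incident_edges_def N_def)
  moreover have "inj_on (\<lambda>u. {v, u}) N" by (auto simp: inj_on_def doubleton_eq_iff)
  ultimately have "label_product E l v = (\<Prod>u\<in>N. l {v, u})"
    by (simp add: label_product_def prod.reindex)
  also have "\<dots> = (\<Prod>u\<in>N. (if l {v, u} = 2 then 2 else 1) * (if l {v, u} = 3 then 3 else 1))"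
    using l by (intro prod.cong) (auto simp: N_def three_labelling_def)
  also have "\<dots> = (\<Prod>u\<in>{u\<in>N. l {v, u} = 2}. 2) * (\<Prod>u\<in>{u\<in>N. l {v, u} = 3}. 3)"
    using finN by (simp only: prod.distrib prod.inter_filter)
  finally show ?thesis by (simp add: label_degree_def N_def)
qed

text \<open>By parity, the exponents of 2 are both zero or both positive, and in the latter case a
  factor 2 cancels. This turns equal vertex products into equal pairs of exponents.\<close>

lemma two_three_powers_inj:
  fixes a b c d :: nat
  assumes "(2::nat) ^ a * 3 ^ b = 2 ^ c * 3 ^ d"
  shows "a = c \<and> b = d"
  using assms
proof (induction a arbitrary: c)
  case 0
  show ?case
  proof (cases c)
    case (Suc c')
    have "odd ((2::nat) ^ 0 * 3 ^ b)" "even ((2::nat) ^ c * 3 ^ d)" using Suc by simp_all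
    then show ?thesis using 0 by metis
  qed (use 0 in simp)
next
  case (Suc a)
  show ?case
  proof (cases c)
    case 0
    have "even ((2::nat) ^ Suc a * 3 ^ b)" "odd ((2::nat) ^ c * 3 ^ d)" using 0 by simp_all
    then show ?thesis using Suc.prems by metis
  next
    case (Suc c')
    then show ?thesis using Suc.IH[of c'] Suc.prems by simp
  qed
qed

section \<open>Colours at least three\<close>

lemma greedy_colouring:
  assumes G: "finite_simple_graph V E"
  obtains c :: "'a \<Rightarrow> nat" where "\<And>v. c v \<ge> 1" "\<And>u v. {u, v} \<in> E \<Longrightarrow> c u \<noteq> c v"
    "\<And>v j. v \<in> V \<Longrightarrow> 1 \<le> j \<Longrightarrow> j < c v \<Longrightarrow> \<exists>u. {v, u} \<in> E \<and> c u = j"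
proof -
  have finV: "finite V" using G by (simp add: finite_simple_graph_def)
  define P where "P c \<longleftrightarrow> (\<forall>v. c v \<ge> (1::nat)) \<and> (\<forall>u v. {u, v} \<in> E \<longrightarrow> c u \<noteq> c v)" for c
  obtain f :: "'a \<Rightarrow> nat" where "inj_on f V"
    using finite_imp_inj_to_nat_seg[OF finV] by auto
  \<comment> \<open>An injective numbering is proper on the edges, and \<open>Suc\<close> makes the
    colours positive.\<close>
  then have "P (Suc \<circ> f)" using edge_endpoints[OF G] by (simp add: P_def inj_on_def) blast
  \<comment> \<open>A proper colouring of minimal colour sum cannot be improved by lowering a single colour.\<close>
  from ex_has_least_nat[of P, OF this, of "\<lambda>c. sum c V"] obtain c
    where c: "P c" and least: "\<And>c'. P c' \<Longrightarrow> sum c V \<le> sum c' V" by auto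
  have "\<exists>u. {v, u} \<in> E \<and> c u = j" if v: "v \<in> V" "1 \<le> j" "j < c v" for v j
  proof (rule ccontr)
    assume no: "\<nexists>u. {v, u} \<in> E \<and> c u = j"
    have no': "c u \<noteq> j" if "{u, v} \<in> E" for u
      using no that by (auto simp: insert_commute)
    have "P (c(v := j))"
      using c v no no' edge_endpoints(3)[OF G, of v v] by (auto simp: P_def)
    moreover have "sum (c(v := j)) V < sum c V"
      using finV v by (intro sum_strict_mono_ex1) auto
    ultimately show False using least[of "c(v := j)"] by simp
  qed
  with c show thesis by (intro that[of c]) (auto simp: P_def)
qed

text \<open>
  The exponents \<open>(a, b)\<close> wanted at a vertex of colour \<open>i\<close>. Only two edges are guaranteed to be available
  at a vertex of colour \<open>3\<close>, which forces the exception there.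
\<close>

definition upper_degrees :: "nat \<Rightarrow> nat \<Rightarrow> nat \<Rightarrow> bool" where
  "upper_degrees i a b \<longleftrightarrow>
     (if odd i then b = i div 2 \<and> even (a + b) \<and> a \<ge> 1 \<and> (i > 3 \<longrightarrow> a \<ge> 2)
      else a = i div 2 \<and> odd (a + b) \<and> b \<ge> 1)"

text \<open>For odd \<open>i\<close>, \<open>b \<ge> 2\<close> means \<open>i > 3\<close> and hence
  \<open>a \<ge> 2\<close>; for even \<open>i\<close>, \<open>a = i div 2\<close> is at least 2
  anyway. The pairs excluded last are those of the matched vertices of colour 2.\<close>

lemma upper_degrees_bichromatic:
  assumes "upper_degrees i a b" "i \<ge> 3"
  shows "a \<ge> 1 \<and> b \<ge> 1 \<and> \<not> (a = 1 \<and> b \<ge> 2)"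
proof -
  have "even i \<Longrightarrow> i div 2 \<ge> 2" "i div 2 \<ge> 1" "i div 2 \<ge> 2 \<Longrightarrow> i > 3"
    using assms(2) by presburger+
  then show ?thesis using assms(1) by (auto simp: upper_degrees_def split: if_splits)
qed

text \<open>The parity of \<open>a + b\<close> reveals the parity of \<open>i\<close>, which tells
  which of \<open>a\<close> and \<open>b\<close> equals \<open>i div 2\<close>.\<close>

lemma upper_degrees_inj:
  assumes "upper_degrees i a b" "upper_degrees j a b"
  shows "i = j"
proof -
  have parity: "odd i \<longleftrightarrow> odd j" using assms unfolding upper_degrees_def by metis
  moreover have "i div 2 = j div 2"
    using assms parity unfolding upper_degrees_def by metis
  ultimately show ?thesis by presburger
qed

text \<open>There are \<open>i div 2\<close> odd and \<open>(i - 1) div 2\<close> even colours below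
  \<open>i\<close>, so the bounds ask for one neighbour per smaller colour. The exponent that starts
  at 0 is filled exactly; the other is corrected in parity and raised to its lower bound.\<close>

lemma upper_degrees_attainable:
  fixes i p q s t :: nat
  assumes "i \<ge> 3" "if odd i then q = 0 else p = 0"
    and s: "i div 2 \<le> s" and t: "(i - 1) div 2 \<le> t"
  obtains x y where "x \<le> s" "y \<le> t" "upper_degrees i (p + x) (q + y)"
proof (cases "odd i")
  case True
  then obtain n where i: "i = 2 * n + 1" by (elim oddE)
  have n: "n \<ge> 1" "n \<le> s" "n \<le> t" "q = 0" using assms i by auto
  have "\<exists>x\<le>n. even (p + x + n) \<and> p + x \<ge> 1 \<and> (n > 1 \<longrightarrow> p + x \<ge> 2)"
  proof -
    \<comment> \<open>The value 3 occurs only for odd \<open>n > 1\<close> and the value 2 only for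
      \<open>n > 1\<close>, so \<open>x \<le> n\<close> throughout.\<close>
    define x :: nat where "x = (if p = 0 then if n = 1 then 1 else if even n then 2 else 3
      else if p = 1 then if n = 1 then 0 else if even n then 1 else 2
      else if even (p + n) then 0 else 1)"
    have "n = 1 \<or> n = 2 \<or> n \<ge> 3" using n by auto
    then show ?thesis by (intro exI[of _ x]) (auto simp: x_def)
  qed
  then obtain x where "x \<le> n" "even (p + x + n)" "p + x \<ge> 1" "n > 1 \<longrightarrow> p + x \<ge> 2" by auto
  then show thesis using i n by (intro that[of x n]) (auto simp: upper_degrees_def)
next
  case False
  then obtain n where i: "i = 2 * n" by auto
  have n: "n \<ge> 2" "n \<le> s" "n - 1 \<le> t" "p = 0" using assms i by auto
  have "\<exists>y\<le>n - 1. odd (n + q + y) \<and> q + y \<ge> 1"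
  proof -
    \<comment> \<open>The value 2 occurs only for odd \<open>n\<close>, hence
      \<open>n \<ge> 3\<close>, so \<open>y \<le> n - 1\<close>.\<close>
    define y :: nat where "y = (if q = 0 then if even n then 1 else 2 else if even (q + n) then 1 else 0)"
    have "n = 2 \<or> n \<ge> 3" using n by auto
    then show ?thesis by (intro exI[of _ y]) (auto simp: y_def)
  qed
  then obtain y where "y \<le> n - 1" "odd (n + q + y)" "q + y \<ge> 1" by auto
  then show thesis using i n by (intro that[of n y]) (auto simp: upper_degrees_def)
qed

text \<open>Colours are settled from the top down; \<open>Inv m\<close> says that those above
  \<open>m\<close> are done and that edges among the others still carry 1. Settling a colour changes
  only edges to smaller colours, so vertices settled before are not disturbed.\<close>

lemma upper_labelling:
  fixes c :: "'a \<Rightarrow> nat"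
  assumes G: "finite_simple_graph V E"
    and proper: "\<And>u v. {u, v} \<in> E \<Longrightarrow> c u \<noteq> c v"
    and greedy: "\<And>v j. v \<in> V \<Longrightarrow> 1 \<le> j \<Longrightarrow> j < c v \<Longrightarrow> \<exists>u. {v, u} \<in> E \<and> c u = j"
  obtains l where "three_labelling E l"
    "\<And>u v. {u, v} \<in> E \<Longrightarrow> c u < c v \<Longrightarrow> c v \<le> 2 \<Longrightarrow> l {u, v} = 1"
    "\<And>u v. {u, v} \<in> E \<Longrightarrow> c u < c v \<Longrightarrow> l {u, v} = 2 \<Longrightarrow> odd (c u)"
    "\<And>u v. {u, v} \<in> E \<Longrightarrow> c u < c v \<Longrightarrow> l {u, v} = 3 \<Longrightarrow> even (c u)"
    "\<And>v. v \<in> V \<Longrightarrow> 2 < c v \<Longrightarrow> upper_degrees (c v) (label_degree E l 2 v) (label_degree E l 3 v)"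
proof -
  have finV: "finite V" using G by (simp add: finite_simple_graph_def)
  define Inv where "Inv m l \<longleftrightarrow> three_labelling E l
      \<and> (\<forall>u v. {u, v} \<in> E \<and> c u < c v \<longrightarrow> (c v \<le> m \<longrightarrow> l {u, v} = 1)
          \<and> (l {u, v} = 2 \<longrightarrow> odd (c u)) \<and> (l {u, v} = 3 \<longrightarrow> even (c u)))
      \<and> (\<forall>v\<in>V. m < c v \<longrightarrow> upper_degrees (c v) (label_degree E l 2 v) (label_degree E l 3 v))"
    for m l
  have bound: "c v \<le> sum c V + 2" if "v \<in> V" for v
    using member_le_sum[OF that _ finV, of c] by simp
  have "\<exists>l. Inv 2 l"
  \<comment> \<open>The induction descends to 2 from a bound on all colours, where no vertex has to
    be settled and the constant labelling 1 qualifies.\<close>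
  proof (rule inc_induct[of 2 "sum c V + 2" "\<lambda>m. \<exists>l. Inv m l"])
    have "Inv (sum c V + 2) (\<lambda>_. 1)"
      using bound by (auto simp: Inv_def three_labelling_def dest: leD)
    then show "\<exists>l. Inv (sum c V + 2) l" by blast
  next
    fix n assume n: "2 \<le> n" and "\<exists>l. Inv (Suc n) l"
    then obtain l where l: "three_labelling E l"
      and one: "\<And>u v. {u, v} \<in> E \<Longrightarrow> c u < c v \<Longrightarrow> c v \<le> Suc n \<Longrightarrow> l {u, v} = 1"
      and two: "\<And>u v. {u, v} \<in> E \<Longrightarrow> c u < c v \<Longrightarrow> l {u, v} = 2 \<Longrightarrow> odd (c u)"
      and three: "\<And>u v. {u, v} \<in> E \<Longrightarrow> c u < c v \<Longrightarrow> l {u, v} = 3 \<Longrightarrow> even (c u)"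
      and upper: "\<And>v. v \<in> V \<Longrightarrow> Suc n < c v \<Longrightarrow>
        upper_degrees (c v) (label_degree E l 2 v) (label_degree E l 3 v)"
      by (auto simp: Inv_def)
    define i where "i = Suc n"
    define Od where "Od v = {u. {v, u} \<in> E \<and> c u < i \<and> odd (c u)}" for v
    define Ev where "Ev v = {u. {v, u} \<in> E \<and> c u < i \<and> even (c u)}" for v
    have "\<exists>P Q. P \<subseteq> Od v \<and> Q \<subseteq> Ev v \<and>
        upper_degrees i (label_degree E l 2 v + card P) (label_degree E l 3 v + card Q)"
      if v: "v \<in> V" "c v = i" for v
    proof -
      have fin: "finite (Od v)" "finite (Ev v)"
        by (auto simp: Od_def Ev_def intro: finite_subset[OF _ finite_neighbours[OF G, of v]])
      \<comment> \<open>The odd colours 1, 3, 5 and so on are halved to 0, 1, 2 and so on, which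
        yields one neighbour per smaller odd colour. Even colours are treated alike, with a shift by
        1.\<close>
      have "{..<i div 2} \<subseteq> (\<lambda>u. c u div 2) ` Od v"
      proof
        fix k assume "k \<in> {..<i div 2}"
        then have "2 * k + 1 < c v" using v by auto
        with greedy[of v "2 * k + 1"] v obtain u where "{v, u} \<in> E" "c u = 2 * k + 1" by auto
        with \<open>2 * k + 1 < c v\<close> v show "k \<in> (\<lambda>u. c u div 2) ` Od v"
          by (intro image_eqI[of _ _ u]) (auto simp: Od_def)
      qed
      from surj_card_le[OF fin(1) this] have s: "i div 2 \<le> card (Od v)" by simp
      have "{..<(i - 1) div 2} \<subseteq> (\<lambda>u. c u div 2 - 1) ` Ev v"
      proof
        fix k assume "k \<in> {..<(i - 1) div 2}"
        then have "2 * k + 2 < c v" using v by auto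
        with greedy[of v "2 * k + 2"] v obtain u where "{v, u} \<in> E" "c u = 2 * k + 2" by auto
        with \<open>2 * k + 2 < c v\<close> v show "k \<in> (\<lambda>u. c u div 2 - 1) ` Ev v"
          by (intro image_eqI[of _ _ u]) (auto simp: Ev_def)
      qed
      from surj_card_le[OF fin(2) this] have t: "(i - 1) div 2 \<le> card (Ev v)" by simp
      \<comment> \<open>A label 2 or 3 already present at \<open>v\<close> lies on an edge whose
        lower end is \<open>v\<close>, so the parity of \<open>i\<close> rules out one of the two
        labels.\<close>
      have dir: "l {v, u} = 1 \<or> c v < c u" if "{v, u} \<in> E" for u
        using one[of u v] proper[OF that] that v by (auto simp: insert_commute i_def)
      have "if odd i then label_degree E l 3 v = 0 else label_degree E l 2 v = 0"
      proof (cases "odd i")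
        case True
        have "label_degree E l 3 v = 0"
          using dir three v True by (intro label_degree_eq_0) fastforce
        then show ?thesis using True by simp
      next
        case False
        have "label_degree E l 2 v = 0"
          using dir two v False by (intro label_degree_eq_0) fastforce
        then show ?thesis using False by simp
      qed
      from upper_degrees_attainable[OF _ this s t] n obtain x y
        where xy: "x \<le> card (Od v)" "y \<le> card (Ev v)"
          "upper_degrees i (label_degree E l 2 v + x) (label_degree E l 3 v + y)"
        by (auto simp: i_def)
      obtain P where "P \<subseteq> Od v" "card P = x" using xy(1) by (meson obtain_subset_with_card_n)
      moreover obtain Q where "Q \<subseteq> Ev v" "card Q = y"
        using xy(2) by (meson obtain_subset_with_card_n)
      ultimately show ?thesis using xy(3) by blast
    qed
    then obtain P Q where PQ: "\<And>v. v \<in> V \<Longrightarrow> c v = i \<Longrightarrow> P v \<subseteq> Od v"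
      "\<And>v. v \<in> V \<Longrightarrow> c v = i \<Longrightarrow> Q v \<subseteq> Ev v"
      "\<And>v. v \<in> V \<Longrightarrow> c v = i \<Longrightarrow>
        upper_degrees i (label_degree E l 2 v + card (P v)) (label_degree E l 3 v + card (Q v))"
      by metis
    define edges where "edges S = {{v, u} | v u. v \<in> V \<and> c v = i \<and> u \<in> S v}" for S :: "'a \<Rightarrow> 'a set"
    define l' where "l' = relabel l (edges P) (edges Q)"
    have P: "{v, u} \<in> E \<and> c u < i \<and> odd (c u)" if "v \<in> V" "c v = i" "u \<in> P v" for u v
      using PQ(1) that by (auto simp: Od_def)
    have Q: "{v, u} \<in> E \<and> c u < i \<and> even (c u)" if "v \<in> V" "c v = i" "u \<in> Q v" for u v
      using PQ(2) that by (auto simp: Ev_def)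
    have inP: "{u, v} \<in> edges P \<longleftrightarrow> v \<in> V \<and> c v = i \<and> u \<in> P v" if "c u < c v" for u v
      using that P by (fastforce simp: edges_def doubleton_eq_iff)
    have inQ: "{u, v} \<in> edges Q \<longleftrightarrow> v \<in> V \<and> c v = i \<and> u \<in> Q v" if "c u < c v" for u v
      using that Q by (fastforce simp: edges_def doubleton_eq_iff)
    have sub: "edges P \<subseteq> E" "edges Q \<subseteq> E" using P Q by (auto simp: edges_def)
    have disj: "edges P \<inter> edges Q = {}"
      using P Q by (fastforce simp: edges_def doubleton_eq_iff)
    have "\<forall>e\<in>edges P \<union> edges Q. l e = 1"
    proof
      fix e assume "e \<in> edges P \<union> edges Q"
      then obtain v u where "e = {u, v}" "v \<in> V" "c v = i" "u \<in> P v \<union> Q v"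
        by (auto simp: edges_def insert_commute)
      then show "l e = 1"
        using one[of u v] P[of v u] Q[of v u] by (auto simp: i_def insert_commute)
    qed
    note deg = label_degree_relabel[OF G sub disj this, folded l'_def]
    \<comment> \<open>A vertex of colour above \<open>n\<close> can only be the upper end of a
      changed edge; this is why settled vertices keep their exponents.\<close>
    have nbrs: "{u. {v, u} \<in> edges S} = (if c v = i then S v else {})"
      if v: "v \<in> V" "n < c v" and S: "\<And>v u. v \<in> V \<Longrightarrow> c v = i \<Longrightarrow> u \<in> S v \<Longrightarrow> c u < i" for S v
    proof -
      have "{v, u} \<in> edges S \<longleftrightarrow> c v = i \<and> u \<in> S v" for u
      proof
        assume "{v, u} \<in> edges S"
        then obtain v' u' where e: "{v, u} = {v', u'}" and v': "v' \<in> V" "c v' = i" "u' \<in> S v'"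
          unfolding edges_def by blast
        have "v \<noteq> u'" using S[OF v'] v(2) by (auto simp: i_def)
        with e v' show "c v = i \<and> u \<in> S v" by (simp add: doubleton_eq_iff)
      next
        assume "c v = i \<and> u \<in> S v"
        with v(1) show "{v, u} \<in> edges S" unfolding edges_def by blast
      qed
      then show ?thesis by auto
    qed
    have degP: "card {u. {v, u} \<in> edges P} = (if c v = i then card (P v) else 0)"
      and degQ: "card {u. {v, u} \<in> edges Q} = (if c v = i then card (Q v) else 0)"
      if "v \<in> V" "n < c v" for v
      using nbrs[OF that, of P] nbrs[OF that, of Q] P Q by auto
    have "Inv n l'"
      unfolding Inv_def
    proof (intro conjI allI impI ballI)
      show "three_labelling E l'" unfolding l'_def by (rule three_labelling_relabel[OF l])
    next
      fix u v assume "{u, v} \<in> E \<and> c u < c v"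
      then have uv: "{u, v} \<in> E" "c u < c v" by auto
      show "l' {u, v} = 1" if "c v \<le> n"
        using that one[OF uv] inP[OF uv(2)] inQ[OF uv(2)] by (simp add: l'_def relabel_def i_def)
      show "odd (c u)" if "l' {u, v} = 2"
        using that two[OF uv] inP[OF uv(2)] P[of v u] by (auto simp: l'_def relabel_def split: if_splits)
      show "even (c u)" if "l' {u, v} = 3"
        using that three[OF uv] inQ[OF uv(2)] Q[of v u] by (auto simp: l'_def relabel_def split: if_splits)
    next
      fix v assume v: "v \<in> V" "n < c v"
      show "upper_degrees (c v) (label_degree E l' 2 v) (label_degree E l' 3 v)"
        using PQ(3)[OF v(1)] upper[OF v(1)] v degP[OF v] degQ[OF v] by (auto simp: deg i_def)
    qed
    then show "\<exists>l. Inv n l" by blast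
  qed simp
  then obtain l where "Inv 2 l" ..
  then show thesis by (intro that[of l]) (auto simp: Inv_def)
qed

section \<open>Combining the upper labelling with the relabelling between colours 1 and 2\<close>

theorem theorem3p1:
  fixes V :: "'a set" and E :: "'a set set"
  assumes "finite_simple_graph V E"
  shows "\<exists>l. three_labelling E l
           \<and> max_degree (product_class V E l 1) (induced_edges E (product_class V E l 1)) \<le> 1
           \<and> (\<forall>x\<ge>2. independent_set V E (product_class V E l x))"
proof -
  note G = assms
  obtain c :: "'a \<Rightarrow> nat" where pos: "\<And>v. c v \<ge> 1"
    and proper: "\<And>u v. {u, v} \<in> E \<Longrightarrow> c u \<noteq> c v"
    and greedy: "\<And>v j. v \<in> V \<Longrightarrow> 1 \<le> j \<Longrightarrow> j < c v \<Longrightarrow> \<exists>u. {v, u} \<in> E \<and> c u = j"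
    using greedy_colouring[OF G] by blast
  obtain l where l: "three_labelling E l"
    and one: "\<And>u v. {u, v} \<in> E \<Longrightarrow> c u < c v \<Longrightarrow> c v \<le> 2 \<Longrightarrow> l {u, v} = 1"
    and two: "\<And>u v. {u, v} \<in> E \<Longrightarrow> c u < c v \<Longrightarrow> l {u, v} = 2 \<Longrightarrow> odd (c u)"
    and three: "\<And>u v. {u, v} \<in> E \<Longrightarrow> c u < c v \<Longrightarrow> l {u, v} = 3 \<Longrightarrow> even (c u)"
    and upper: "\<And>v. v \<in> V \<Longrightarrow> 2 < c v \<Longrightarrow>
      upper_degrees (c v) (label_degree E l 2 v) (label_degree E l 3 v)"
    using upper_labelling[of V E c, OF G proper greedy] by blast
  define X where "X = {v\<in>V. c v = 1}"
  define Y where "Y = {v\<in>V. c v = 2}"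
  define R where "R = {(x, y). {x, y} \<in> E \<and> c x = 1 \<and> c y = 2}"
  have finV: "finite V" using G by (simp add: finite_simple_graph_def)
  have XY: "finite X" "finite Y" "R \<subseteq> X \<times> Y"
    using finV edge_endpoints[OF G] by (auto simp: X_def Y_def R_def)
  obtain F H a b a' b' where FR: "F \<subseteq> R" and HR: "H \<subseteq> R" and FH: "F \<inter> H = {}"
    and a: "\<And>x. a x = label_degree E l 2 x + card (F `` {x})"
    and b: "\<And>x. b x = card (H `` {x})"
    and a': "\<And>y. a' y = card (F\<inverse> `` {y})"
    and b': "\<And>y. b' y = label_degree E l 3 y + card (H\<inverse> `` {y})"
    and monoX: "\<And>x. x \<in> X \<Longrightarrow> a x = 0 \<or> b x = 0"
    and monoY: "\<And>y. y \<in> Y \<Longrightarrow> a' y = 0 \<or> b' y = 0 \<or> a' y = 1 \<and> b' y \<ge> 2"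
    and conflict: "\<And>x y. (x, y) \<in> R \<Longrightarrow> a x = a' y \<Longrightarrow> b x = b' y \<Longrightarrow> a x = 0 \<and> b x = 0"
    and uniqX: "\<And>x y y'. (x, y) \<in> R \<Longrightarrow> (x, y') \<in> R \<Longrightarrow> a x = 0 \<Longrightarrow> b x = 0 \<Longrightarrow>
       a' y = 0 \<Longrightarrow> b' y = 0 \<Longrightarrow> a' y' = 0 \<Longrightarrow> b' y' = 0 \<Longrightarrow> y = y'"
    and uniqY: "\<And>x x' y. (x, y) \<in> R \<Longrightarrow> (x', y) \<in> R \<Longrightarrow> a' y = 0 \<Longrightarrow> b' y = 0 \<Longrightarrow>
       a x = 0 \<Longrightarrow> b x = 0 \<Longrightarrow> a x' = 0 \<Longrightarrow> b x' = 0 \<Longrightarrow> x = x'"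
  proof (rule bipartite_relabelling[OF XY, of "label_degree E l 2" "label_degree E l 3"], goal_cases)
    case (1 F H a b a' b')
    show ?case by (rule 1(1)[OF 1(2-)])
  qed
  define edges where "edges S = {{x, y} | x y. (x, y) \<in> S}" for S :: "('a \<times> 'a) set"
  define l' where "l' = relabel l (edges F) (edges H)"
  have R: "{x, y} \<in> E" "c x = 1" "c y = 2" if "(x, y) \<in> R" for x y
    using that by (auto simp: R_def)
  have sub: "edges F \<subseteq> E" "edges H \<subseteq> E" using FR HR R by (auto simp: edges_def)
  have disj: "edges F \<inter> edges H = {}"
    using FR HR FH R by (fastforce simp: edges_def doubleton_eq_iff)
  have "\<forall>e\<in>edges F \<union> edges H. l e = 1"
    using FR HR R one by (fastforce simp: edges_def)
  note deg = label_degree_relabel[OF G sub disj this, folded l'_def]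
  have l': "three_labelling E l'" unfolding l'_def by (rule three_labelling_relabel[OF l])
  have nbrs: "{u. {v, u} \<in> edges S}
      = (if c v = 1 then S `` {v} else if c v = 2 then S\<inverse> `` {v} else {})" if "S \<subseteq> R" for S v
  proof -
    have "{u. {v, u} \<in> edges S} = S `` {v} \<union> S\<inverse> `` {v}"
      by (auto simp: edges_def doubleton_eq_iff)
    moreover have "c v \<noteq> 1 \<Longrightarrow> S `` {v} = {}" "c v \<noteq> 2 \<Longrightarrow> S\<inverse> `` {v} = {}"
      using that R(2,3) by blast+
    ultimately show ?thesis by auto
  qed
  \<comment> \<open>Every edge at a vertex of colour 1 has it as its lower end, which is odd, so no
    3 occurs. At colour 2, edges upwards carry no 2 and edges downwards are still labelled
    1.\<close>
  have X_3: "label_degree E l 3 v = 0" if "c v = 1" for v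
  proof -
    have "c v < c u" if "{v, u} \<in> E" for u
      using \<open>c v = 1\<close> pos[of u] proper[OF that] by auto
    then show ?thesis using three that by (intro label_degree_eq_0) fastforce
  qed
  have Y_2: "label_degree E l 2 v = 0" if "c v = 2" for v
  proof -
    have "l {v, u} = 1 \<or> c v < c u" if "{v, u} \<in> E" for u
      using \<open>c v = 2\<close> proper[OF that] one[of u v] that by (auto simp: insert_commute)
    then show ?thesis using two that by (intro label_degree_eq_0) fastforce
  qed
  define L2 where "L2 = label_degree E l' 2"
  define L3 where "L3 = label_degree E l' 3"
  have LX: "L2 v = a v" "L3 v = b v" if "c v = 1" for v
    using that X_3 by (simp_all add: L2_def L3_def deg nbrs FR HR a b)
  have LY: "L2 v = a' v" "L3 v = b' v" if "c v = 2" for v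
    using that Y_2 by (simp_all add: L2_def L3_def deg nbrs FR HR a' b')
  have LU: "upper_degrees (c v) (L2 v) (L3 v)" if "v \<in> V" "2 < c v" for v
    using that upper by (simp add: L2_def L3_def deg nbrs FR HR)
  have bichromatic: "L2 v \<ge> 1 \<and> L3 v \<ge> 1 \<and> \<not> (L2 v = 1 \<and> L3 v \<ge> 2)" if "v \<in> V" "2 < c v" for v
    using upper_degrees_bichromatic[OF LU[OF that]] that by simp
  have low: "c v = 1 \<or> c v = 2 \<or> 2 < c v" for v using pos[of v] by linarith
  \<comment> \<open>None of these exponent pairs is compatible with \<open>bichromatic\<close>, so
    colours 1 and 2 never clash with larger ones.\<close>
  have lower: "L2 v = 0 \<or> L3 v = 0 \<or> L2 v = 1 \<and> L3 v \<ge> 2" if "v \<in> V" "c v = 1 \<or> c v = 2" for v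
    using that monoX[of v] monoY[of v] LX[of v] LY[of v] by (auto simp: X_def Y_def)
  have ordered: "L2 u = 0 \<and> L3 u = 0"
    if uv: "{u, v} \<in> E" "c u < c v" and eq: "L2 u = L2 v" "L3 u = L3 v" for u v
  proof -
    have V: "u \<in> V" "v \<in> V" using edge_endpoints[OF G uv(1)] by auto
    consider "c u = 1" "c v = 2" | "c u \<le> 2" "2 < c v" | "2 < c u" "2 < c v"
      using low[of u] low[of v] uv(2) by linarith
    then show ?thesis
    proof cases
      case 1
      then show ?thesis using conflict[of u v] uv(1) eq by (simp add: R_def LX LY)
    next
      case 2
      then have "c u = 1 \<or> c u = 2" using low[of u] by auto
      from lower[OF V(1) this] bichromatic[OF V(2) 2(2)] show ?thesis unfolding eq by auto
    next
      case 3
      then show ?thesis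
        using upper_degrees_inj[OF LU[OF V(1), unfolded eq] LU[OF V(2)]] uv(2) by simp
    qed
  qed
  have eq_zero: "L2 u = 0 \<and> L3 u = 0" if "{u, v} \<in> E" "L2 u = L2 v" "L3 u = L3 v" for u v
  proof (cases "c u < c v")
    case True
    then show ?thesis using ordered that by blast
  next
    case False
    then have "c v < c u" using proper[OF that(1)] by simp
    then show ?thesis using ordered[of v u] that by (simp add: insert_commute)
  qed
  \<comment> \<open>Vertices of larger colour are bichromatic, so all three vertices have colour 1
    or 2, with \<open>v\<close> and \<open>v'\<close> in the class opposite to \<open>u\<close>.
    Then \<open>uniqX\<close> or \<open>uniqY\<close> applies, according to the colour of
    \<open>u\<close>.\<close>
  have unique: "v = v'" if e: "{u, v} \<in> E" "{u, v'} \<in> E" and "L2 u = 0" "L3 u = 0"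
    "L2 v = 0" "L3 v = 0" "L2 v' = 0" "L3 v' = 0" for u v v'
  proof -
    have V: "u \<in> V" "v \<in> V" "v' \<in> V" using edge_endpoints[OF G] e by blast+
    then have low': "c w = 1 \<or> c w = 2" if "w \<in> {u, v, v'}" for w
      using bichromatic[of w] low[of w] that \<open>L2 u = 0\<close> \<open>L2 v = 0\<close> \<open>L2 v' = 0\<close> by auto
    have "c u \<noteq> c v" "c u \<noteq> c v'" using proper e by auto
    then consider "c u = 1" "c v = 2" "c v' = 2" | "c u = 2" "c v = 1" "c v' = 1"
      using low'[of u] low'[of v] low'[of v'] by fastforce
    then show ?thesis
    proof cases
      case 1
      then show ?thesis using uniqX[of u v v'] that by (simp add: R_def LX LY)
    next
      case 2
      then show ?thesis using uniqY[of v u v'] that by (simp add: R_def LX LY insert_commute)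
    qed
  qed
  have prod: "label_product E l' v = 2 ^ L2 v * 3 ^ L3 v" for v
    unfolding L2_def L3_def by (rule label_product_eq[OF G l'])
  define S where "S = product_class V E l' 1"
  have S: "L2 v = 0 \<and> L3 v = 0" if "v \<in> S" for v
  proof -
    have "label_product E l' v = 2 ^ 0 * 3 ^ 0" using that by (simp add: S_def product_class_def)
    then show ?thesis unfolding prod by (rule two_three_powers_inj)
  qed
  have "degree (induced_edges E S) v \<le> 1" if "v \<in> S" for v
  proof -
    have "finite E"
      using finite_subset[of E "Pow V"] G by (auto simp: finite_simple_graph_def)
    then have fin: "finite (incident_edges (induced_edges E S) v)"
      by (simp add: incident_edges_def induced_edges_def)
    have "\<exists>u\<in>S. e = {v, u}" if e: "e \<in> incident_edges (induced_edges E S) v" for e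
    proof -
      have "e \<in> E" "e \<subseteq> S" "v \<in> e" using e by (auto simp: incident_edges_def induced_edges_def)
      moreover obtain x y where "e = {x, y}"
        using G \<open>e \<in> E\<close> by (auto simp: finite_simple_graph_def card_2_iff)
      ultimately show ?thesis by auto
    qed
    note other_end = this
    have "e = e'" if e: "e \<in> incident_edges (induced_edges E S) v"
      "e' \<in> incident_edges (induced_edges E S) v" for e e'
    proof -
      obtain u u' where u: "u \<in> S" "e = {v, u}" "u' \<in> S" "e' = {v, u'}"
        using other_end e by blast
      then have "{v, u} \<in> E" "{v, u'} \<in> E"
        using e by (auto simp: incident_edges_def induced_edges_def)
      then show ?thesis using unique[of v u u'] S[OF \<open>v \<in> S\<close>] S[of u] S[of u'] u by simp
    qed
    then show ?thesis unfolding degree_def using card_le_one_iff_unique[OF fin] by blast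
  qed
  moreover have "finite S" using finV by (simp add: S_def product_class_def)
  ultimately have "max_degree S (induced_edges E S) \<le> 1" by (simp add: max_degree_def)
  moreover have "independent_set V E (product_class V E l' x)" if "x \<ge> 2" for x
  proof -
    have "{u, v} \<notin> E" if "label_product E l' u = x" "label_product E l' v = x" for u v
    proof
      assume "{u, v} \<in> E"
      moreover have "label_product E l' u = label_product E l' v" using that by simp
      then have "L2 u = L2 v \<and> L3 u = L3 v" unfolding prod by (rule two_three_powers_inj)
      ultimately have "L2 u = 0 \<and> L3 u = 0" using eq_zero by blast
      then have "label_product E l' u = 1" by (simp add: prod)
      then show False using that \<open>x \<ge> 2\<close> by simp
    qed
    then show ?thesis by (auto simp: independent_set_def product_class_def)
  qed
  ultimately show ?thesis using l' unfolding S_def by blast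
qed

end
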